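(* Let $(X,d)$ be a compact metric space. If $\{x_n\}_{n\in\mathbb{N}}$ is a sequence in $X$, $\{f^n\}_{n\in\mathbb{N}}$ is an equicontinuous sequence of real functions on $X$ with $f^1\le f^2\le f^3\le\cdots$, and $f$ is a continuous real function on $X$, then the following conditions are equivalent: (a) $\lim_{m,n\to\infty}f^m(x_n)-f(x_n)=0$; (b) $\lim_{n\to\infty}f^n(x_n)-f(x_n)=0$. Moreover, if (a) or (b) holds then $f^n$ converges uniformly to a continuous function which coincides with $f$ on the set $$Y_*=\Big\{y\in X:\ y=\lim_{j\to\infty}x_{n_j}\text{ for some subsequence }\{x_{n_j}\}_{j\in\mathbb{N}}\Big\}.$$
   Context: In (a) the limit is the double limit as $m$ and $n$ tend to infinity independently. Uniform convergence is on $X$.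
   Formalization: The "Moreover" part additionally assumes that the sequence f^n(y) is bounded above for each y in X; without this it fails, e.g. X={0,1}, x_n=0, f^n(y)=ny, f=0. *)

theory Defs
  imports "HOL-Analysis.Analysis"
begin

(* Equicontinuity at every point of S, relative to S; for compact S this is the same as
   uniform equicontinuity.  It does not include any boundedness of the family. *)
definition equicontinuous_seq_on ::
    "'a::metric_space set \<Rightarrow> (nat \<Rightarrow> 'a \<Rightarrow> real) \<Rightarrow> bool" where
  "equicontinuous_seq_on S f \<longleftrightarrow>
     (\<forall>x\<in>S. \<forall>e>0. \<exists>d>0. \<forall>n. \<forall>y\<in>S. dist y x < d \<longrightarrow> \<bar>f n y - f n x\<bar> < e)"

definition subseq_limits :: "'a::metric_space set \<Rightarrow> (nat \<Rightarrow> 'a) \<Rightarrow> 'a set" where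
  "subseq_limits S x =
     {y \<in> S. \<exists>r. strict_mono (r :: nat \<Rightarrow> nat) \<and> (\<lambda>j. x (r j)) \<longlonglongrightarrow> y}"

end

theory Submission
  imports Defs
begin

text \<open>
  The proof rests on one consequence of equicontinuity: if \<open>z k\<close> tends to \<open>y\<close>, then
  \<open>f (m k) (z k) - f (m k) y\<close> tends to zero for any choice of the indices \<open>m k\<close>
  (\<open>equicontinuous_seq_on_tendsto_diff\<close>), so that values of \<open>f (m k)\<close> along a convergent
  sequence can be replaced by values at the limit point.

  The diagonal condition (b) therefore gives \<open>f (r k) y \<longlonglongrightarrow> g y\<close> whenever
  \<open>x (r k) \<longlonglongrightarrow> y\<close>.  This is only a statement about some of the indices, but \<open>f n y\<close> is
  increasing in \<open>n\<close>, hence \<open>f n y \<longlonglongrightarrow> g y\<close> along all of them: the limit of the functions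
  exists and equals \<open>g\<close> at every subsequential limit of \<open>x\<close>
  (\<open>diagonal_limit_imp_limit_at_cluster_point\<close>).  This is where monotonicity decouples the
  index of the function from the index of the point.  Condition (a) follows by compactness: if it
  failed, there would be \<open>m k\<close> and \<open>n k\<close> tending to infinity with \<open>f (m k) (x (n k))\<close> bounded
  away from \<open>g (x (n k))\<close>, and one could let \<open>x (n k)\<close> converge to some \<open>y\<close>, at which both
  quantities tend to \<open>g y\<close>.

  When the values at each point are bounded, monotonicity makes \<open>f n\<close> converge pointwise, and for
  equicontinuous sequences on a compact set pointwise convergence is automatically uniform, by the
  same extraction argument.
\<close>

lemma equicontinuous_seq_on_tendsto_diff:
  fixes f :: "nat \<Rightarrow> 'a::metric_space \<Rightarrow> real"
  assumes eq: "equicontinuous_seq_on S f" and y: "y \<in> S"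
    and z: "\<And>k. z k \<in> S" and lim: "(z \<longlongrightarrow> y) F"
  shows "((\<lambda>k. f (m k) (z k) - f (m k) y) \<longlongrightarrow> 0) F"
proof (rule tendstoI)
  fix e :: real assume "e > 0"
  with eq y obtain d where "d > 0"
    and d: "\<And>n u. u \<in> S \<Longrightarrow> dist u y < d \<Longrightarrow> \<bar>f n u - f n y\<bar> < e"
    unfolding equicontinuous_seq_on_def by meson
  from tendstoD[OF lim \<open>d > 0\<close>]
  show "\<forall>\<^sub>F k in F. dist (f (m k) (z k) - f (m k) y) 0 < e"
    by eventually_elim (simp add: d z)
qed

lemma equicontinuous_seq_on_tendsto:
  fixes f :: "nat \<Rightarrow> 'a::metric_space \<Rightarrow> real"
  assumes "equicontinuous_seq_on S f" "y \<in> S" "\<And>k. z k \<in> S" "(z \<longlongrightarrow> y) F"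
    and m: "filterlim m sequentially F" and lim: "(\<lambda>n. f n y) \<longlonglongrightarrow> L"
  shows "((\<lambda>k. f (m k) (z k)) \<longlongrightarrow> L) F"
proof -
  have "((\<lambda>k. (f (m k) (z k) - f (m k) y) + f (m k) y) \<longlongrightarrow> 0 + L) F"
    by (intro tendsto_add equicontinuous_seq_on_tendsto_diff[OF assms(1-4)]
        filterlim_compose[OF lim m])
  then show ?thesis by simp
qed

lemma equicontinuous_seq_on_limit_continuous:
  fixes f :: "nat \<Rightarrow> 'a::metric_space \<Rightarrow> real"
  assumes eq: "equicontinuous_seq_on S f"
    and lim: "\<And>y. y \<in> S \<Longrightarrow> (\<lambda>n. f n y) \<longlonglongrightarrow> h y"
  shows "continuous_on S h"
  unfolding continuous_on_iff
proof (intro ballI allI impI)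
  fix y and e :: real assume y: "y \<in> S" and "e > 0"
  with eq have "\<exists>d>0. \<forall>n. \<forall>u\<in>S. dist u y < d \<longrightarrow> \<bar>f n u - f n y\<bar> < e / 2"
    unfolding equicontinuous_seq_on_def by (meson half_gt_zero)
  then obtain d where "d > 0"
    and d: "\<And>n u. u \<in> S \<Longrightarrow> dist u y < d \<Longrightarrow> \<bar>f n u - f n y\<bar> < e / 2"
    by blast
  have "dist (h u) (h y) < e" if u: "u \<in> S" "dist u y < d" for u
  proof -
    have "(\<lambda>n. \<bar>f n u - f n y\<bar>) \<longlonglongrightarrow> \<bar>h u - h y\<bar>"
      by (intro tendsto_intros lim u y)
    then have "\<bar>h u - h y\<bar> \<le> e / 2"
      by (rule LIMSEQ_le_const2) (use d[OF u] less_imp_le in blast)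
    then show ?thesis using \<open>e > 0\<close> by (simp add: dist_real_def)
  qed
  then show "\<exists>d>0. \<forall>u\<in>S. dist u y < d \<longrightarrow> dist (h u) (h y) < e"
    using \<open>d > 0\<close> by blast
qed

text \<open>
  If uniformity failed, there would be indices \<open>n k \<ge> k\<close> and points \<open>z k\<close> at which \<open>f (n k)\<close>
  stays away from \<open>h\<close>; near a cluster point \<open>y\<close> of these points both are close to \<open>h y\<close>.
\<close>

lemma equicontinuous_seq_on_compact_uniform_limit:
  fixes f :: "nat \<Rightarrow> 'a::metric_space \<Rightarrow> real"
  assumes S: "compact S" and eq: "equicontinuous_seq_on S f"
    and lim: "\<And>y. y \<in> S \<Longrightarrow> (\<lambda>n. f n y) \<longlonglongrightarrow> h y"
  shows "uniform_limit S f h sequentially"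
proof (rule ccontr)
  assume "\<not> uniform_limit S f h sequentially"
  then obtain e where "e > 0"
    and "\<forall>N. \<exists>n\<ge>N. \<exists>z\<in>S. dist (f n z) (h z) \<ge> e"
    unfolding uniform_limit_iff eventually_sequentially by (meson not_le)
  then obtain n z where n: "\<And>k. k \<le> n k" and z: "\<And>k. z k \<in> S"
    and far: "\<And>k. dist (f (n k) (z k)) (h (z k)) \<ge> e"
    by metis
  obtain y r where y: "y \<in> S" and r: "strict_mono r" and zr: "(\<lambda>k. z (r k)) \<longlonglongrightarrow> y"
    using S z unfolding compact_def o_def by metis
  have "filterlim n sequentially sequentially"
    by (rule filterlim_at_top_mono[OF filterlim_ident]) (simp add: n)
  then have nr: "filterlim (\<lambda>k. n (r k)) sequentially sequentially"
    using filterlim_compose filterlim_subseq[OF r] by blast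
  have "(\<lambda>k. f (n (r k)) (z (r k))) \<longlonglongrightarrow> h y"
    using equicontinuous_seq_on_tendsto[OF eq y z zr nr lim[OF y]] .
  moreover have "(\<lambda>k. h (z (r k))) \<longlonglongrightarrow> h y"
    by (rule continuous_on_tendsto_compose
        [OF equicontinuous_seq_on_limit_continuous[OF eq lim] zr y]) (simp_all add: z)
  ultimately have "(\<lambda>k. dist (f (n (r k)) (z (r k))) (h (z (r k)))) \<longlonglongrightarrow> dist (h y) (h y)"
    by (rule tendsto_dist)
  then have "e \<le> dist (h y) (h y)"
    by (rule LIMSEQ_le_const) (use far in blast)
  with \<open>e > 0\<close> show False by simp
qed

lemma incseq_LIMSEQ_if_subsequence_LIMSEQ:
  fixes u :: "nat \<Rightarrow> 'a::linorder_topology"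
  assumes u: "incseq u" and r: "filterlim r sequentially sequentially"
    and lim: "(\<lambda>k. u (r k)) \<longlonglongrightarrow> L"
  shows "u \<longlonglongrightarrow> L"
proof (rule order_tendstoI)
  fix c assume "c < L"
  from order_tendstoD(1)[OF lim this] obtain k where "c < u (r k)"
    unfolding eventually_sequentially by blast
  then show "\<forall>\<^sub>F n in sequentially. c < u n"
    unfolding eventually_sequentially using u by (meson incseqD less_le_trans)
next
  fix c assume "L < c"
  have "u n \<le> L" for n
  proof -
    have "\<forall>\<^sub>F k in sequentially. n \<le> r k"
      using r by (simp add: filterlim_at_top)
    then have "\<forall>\<^sub>F k in sequentially. u n \<le> u (r k)"
      by eventually_elim (use u in \<open>simp add: incseqD\<close>)
    then show ?thesis
      using tendsto_lowerbound[OF lim] by simp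
  qed
  then have "u n < c" for n
    using \<open>L < c\<close> by (rule le_less_trans)
  then show "\<forall>\<^sub>F n in sequentially. u n < c"
    by simp
qed

text \<open>
  Equicontinuity moves the evaluation point from \<open>x (r k)\<close> to \<open>y\<close>, and monotonicity then passes
  from the indices \<open>r k\<close> to all indices.  Divergence of \<open>r\<close> is required instead of strict
  monotonicity, so that the result applies to indices obtained by a choice.
\<close>

lemma diagonal_limit_imp_limit_at_cluster_point:
  fixes f :: "nat \<Rightarrow> 'a::metric_space \<Rightarrow> real"
  assumes eq: "equicontinuous_seq_on S f" and x: "\<And>n. x n \<in> S" and y: "y \<in> S"
    and mono: "incseq (\<lambda>n. f n y)" and g: "continuous_on S g"
    and diag: "(\<lambda>n. f n (x n) - g (x n)) \<longlonglongrightarrow> 0"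
    and r: "filterlim r sequentially sequentially" and lim: "(\<lambda>k. x (r k)) \<longlonglongrightarrow> y"
  shows "(\<lambda>n. f n y) \<longlonglongrightarrow> g y"
proof (rule incseq_LIMSEQ_if_subsequence_LIMSEQ[OF mono r])
  have 1: "(\<lambda>k. f (r k) (x (r k)) - f (r k) y) \<longlonglongrightarrow> 0"
    by (rule equicontinuous_seq_on_tendsto_diff[OF eq y x lim])
  have 2: "(\<lambda>k. g (x (r k))) \<longlonglongrightarrow> g y"
    by (rule continuous_on_tendsto_compose[OF g lim y]) (simp add: x)
  from tendsto_diff[OF tendsto_add[OF filterlim_compose[OF diag r] 2] 1]
  show "(\<lambda>k. f (r k) y) \<longlonglongrightarrow> g y" by simp
qed

lemma diagonal_limit_imp_double_limit:
  fixes f :: "nat \<Rightarrow> 'a::metric_space \<Rightarrow> real"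
  assumes S: "compact S" and eq: "equicontinuous_seq_on S f" and x: "\<And>n. x n \<in> S"
    and mono: "\<And>y. y \<in> S \<Longrightarrow> incseq (\<lambda>n. f n y)" and g: "continuous_on S g"
    and diag: "(\<lambda>n. f n (x n) - g (x n)) \<longlonglongrightarrow> 0"
  shows "((\<lambda>(m, n). f m (x n) - g (x n)) \<longlongrightarrow> 0) (sequentially \<times>\<^sub>F sequentially)"
proof (rule ccontr)
  assume "\<not> ?thesis"
  then obtain e where "e > 0"
    and "\<forall>N. \<exists>n\<ge>N. \<exists>m\<ge>N. \<bar>f m (x n) - g (x n)\<bar> \<ge> e"
    unfolding tendsto_iff eventually_prod_sequentially by (auto simp: not_less)
  then obtain n m where n: "\<And>k. k \<le> n k" and m: "\<And>k. k \<le> m k"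
    and far: "\<And>k. \<bar>f (m k) (x (n k)) - g (x (n k))\<bar> \<ge> e"
    by metis
  obtain y r where y: "y \<in> S" and r: "strict_mono r" and xr: "(\<lambda>k. x (n (r k))) \<longlonglongrightarrow> y"
    using S[unfolded compact_def, rule_format, of "\<lambda>k. x (n k)"] x unfolding o_def by metis
  have "filterlim n sequentially sequentially" "filterlim m sequentially sequentially"
    by (rule filterlim_at_top_mono[OF filterlim_ident], simp add: n m)+
  then have nr: "filterlim (\<lambda>k. n (r k)) sequentially sequentially"
    and mr: "filterlim (\<lambda>k. m (r k)) sequentially sequentially"
    using filterlim_compose filterlim_subseq[OF r] by blast+
  have "(\<lambda>n. f n y) \<longlonglongrightarrow> g y"
    by (rule diagonal_limit_imp_limit_at_cluster_point[OF eq x y mono[OF y] g diag nr xr])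
  then have "(\<lambda>k. f (m (r k)) (x (n (r k)))) \<longlonglongrightarrow> g y"
    by (rule equicontinuous_seq_on_tendsto[OF eq y x xr mr])
  moreover have "(\<lambda>k. g (x (n (r k)))) \<longlonglongrightarrow> g y"
    by (rule continuous_on_tendsto_compose[OF g xr y]) (simp add: x)
  ultimately have "(\<lambda>k. \<bar>f (m (r k)) (x (n (r k))) - g (x (n (r k)))\<bar>) \<longlonglongrightarrow> \<bar>g y - g y\<bar>"
    by (intro tendsto_intros)
  then have "e \<le> \<bar>g y - g y\<bar>"
    by (rule LIMSEQ_le_const) (use far in blast)
  with \<open>e > 0\<close> show False by simp
qed

theorem lemma5p1:
  fixes X :: "'a::metric_space set"
    and x :: "nat \<Rightarrow> 'a"
    and f :: "nat \<Rightarrow> 'a \<Rightarrow> real"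
    and g :: "'a \<Rightarrow> real"
  assumes "compact X"
    and "\<And>n. x n \<in> X"
    and "equicontinuous_seq_on X f"
    and "\<And>n y. y \<in> X \<Longrightarrow> f n y \<le> f (Suc n) y"
    and "continuous_on X g"
  defines "a \<equiv> ((\<lambda>(m, n). f m (x n) - g (x n)) \<longlongrightarrow> 0) (sequentially \<times>\<^sub>F sequentially)"
    and "b \<equiv> (\<lambda>n. f n (x n) - g (x n)) \<longlonglongrightarrow> 0"
  shows "(a \<longleftrightarrow> b) \<and>
         (a \<or> b \<longrightarrow> (\<forall>y\<in>X. bdd_above (range (\<lambda>n. f n y))) \<longrightarrow>
           (\<exists>h. continuous_on X h \<and> uniform_limit X f h sequentially \<and>
                (\<forall>y\<in>subseq_limits X x. h y = g y)))"
proof -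
  have mono: "incseq (\<lambda>n. f n y)" if "y \<in> X" for y
    using assms(4)[OF that] by (rule incseq_SucI)
  have "b" if "a"
  proof -
    have "filterlim (\<lambda>n. (n, n)) (sequentially \<times>\<^sub>F sequentially) sequentially"
      by (intro filterlim_Pair filterlim_ident)
    from filterlim_compose[OF that[unfolded a_def] this] show "b"
      by (simp add: b_def)
  qed
  moreover have "a" if "b"
    using diagonal_limit_imp_double_limit[OF assms(1,3,2) mono assms(5)] that
    unfolding a_def b_def by simp
  ultimately have ab: "a \<longleftrightarrow> b" by blast
  have "\<exists>h. continuous_on X h \<and> uniform_limit X f h sequentially \<and>
            (\<forall>y\<in>subseq_limits X x. h y = g y)"
    if "b" and bdd: "\<forall>y\<in>X. bdd_above (range (\<lambda>n. f n y))"
  proof -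
    define h where "h y = (SUP n. f n y)" for y
    have lim: "(\<lambda>n. f n y) \<longlonglongrightarrow> h y" if "y \<in> X" for y
      unfolding h_def using bdd mono that by (intro LIMSEQ_incseq_SUP) auto
    have "h y = g y" if y_cluster: "y \<in> subseq_limits X x" for y
    proof -
      obtain r where y: "y \<in> X" and r: "strict_mono r" and xr: "(\<lambda>k. x (r k)) \<longlonglongrightarrow> y"
        using y_cluster unfolding subseq_limits_def by blast
      have "(\<lambda>n. f n y) \<longlonglongrightarrow> g y"
        by (rule diagonal_limit_imp_limit_at_cluster_point
            [OF assms(3,2) y mono[OF y] assms(5) \<open>b\<close>[unfolded b_def] filterlim_subseq[OF r] xr])
      with lim[OF y] show ?thesis by (rule LIMSEQ_unique)
    qed
    then show ?thesis
      using equicontinuous_seq_on_limit_continuous[OF assms(3) lim]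
        equicontinuous_seq_on_compact_uniform_limit[OF assms(1,3) lim] by blast
  qed
  with ab show ?thesis by blast
qed

end
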